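(* Let $P=(p_1,\dots,p_n)$ be a real pattern with break regions $[l_k,r_k]$ ($1\le k\le b-1$) and thresholds $\varepsilon_1,\dots,\varepsilon_b\ge 0$, let $S=(S_1,S_2,\dots)$ be a real sequence, let $w$ be an integer with $1\le w\le n$, and let $N=\lfloor n/w\rfloor$. For $1\le k\le b$ put $md(k)=\varepsilon_k\sqrt{r_k-l_{k-1}}$, and for $1\le i\le n$ define $$\theta_{ele}(i)=\begin{cases}\max(md(k),md(k+1)), & i\in(l_k,r_k]\ \ (1\le k\le b-1),\\ md(k), & i\in(r_{k-1},l_k]\ \ (1\le k\le b),\end{cases}$$ $U_i=p_i+\theta_{ele}(i)$, $L_i=p_i-\theta_{ele}(i)$. For $1\le j\le N$ define $$\hat P^u_j=\max_{0\le i<w}U_{jw-i},\qquad \hat P^l_j=\min_{0\le i<w}L_{jw-i},\qquad \hat W^f_{t,j}=s_{t,jw}.$$ Then the element-based equal-length block representation satisfies the lower bounding property: for every $t\ge1$, if there exists $i\in\{0,1,\dots,w-1\}$ such that the window $W_{t+i}$ is a fine-grained matching result of $P$, then for all $j\in\{1,\dots,N\}$, $$\hat P^l_j\le \hat W^f_{t,j}\le \hat P^u_j .$$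
   Context: For equal-length real sequences, $ED_{norm}(X,Y)=\sqrt{\frac1m\sum_{i=1}^m|x_i-y_i|^2}$, where $m$ is their common length. $X[i:j]$ denotes $(x_i,\dots,x_j)$. Break regions: the number of segments is $b\ge1$; $[l_k,r_k]$, $1\le k\le b-1$, are integer intervals that are pairwise non-overlapping and ordered, contained in $[1,n-1]$, i.e. $1\le l_1\le r_1<l_2\le r_2<\dots<l_{b-1}\le r_{b-1}\le n-1$. By convention $l_0=r_0=0$ and $l_b=r_b=n$. A segmentation is a choice of integers (breakpoints) $bp_k\in[l_k,r_k]$ for $1\le k\le b-1$, with $bp_0=0$ and $bp_b=n$. The sliding window starting at $t$ is $W_t=(s_{t,1},\dots,s_{t,n})$ with $s_{t,i}=S_{t+i-1}$. $W_t$ is a fine-grained matching result of $P$ if there exists a segmentation such that for every $k\in\{1,\dots,b\}$, $$ED_{norm}\big(P[bp_{k-1}+1:bp_k],\,W_t[bp_{k-1}+1:bp_k]\big)\le\varepsilon_k.$$ *)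

theory Defs
  imports Complex_Main
begin

text \<open>
  The sequences \<open>P = (p\<^sub>1, \<dots>, p\<^sub>n)\<close> and \<open>S = (S\<^sub>1, S\<^sub>2, \<dots>)\<close> are
  functions on \<open>nat\<close> with 1-based indices. Only their values on the stated index range are
  ever used, so an arbitrary function stands for an arbitrary sequence.
\<close>

definition subsequence :: "(nat \<Rightarrow> real) \<Rightarrow> nat \<Rightarrow> nat \<Rightarrow> real list" where
  "subsequence X i j = map X [i..<Suc j]"

text \<open>Meant for lists of equal length only.\<close>

definition ED_norm :: "real list \<Rightarrow> real list \<Rightarrow> real" where
  "ED_norm xs ys =
     sqrt (1 / real (length xs) * (\<Sum>i<length xs. \<bar>xs ! i - ys ! i\<bar> ^ 2))"

text \<open>\<open>l\<close> and \<open>r\<close> carry the boundary conventions at indices 0 and \<open>b\<close>.\<close>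

definition break_regions :: "nat \<Rightarrow> nat \<Rightarrow> (nat \<Rightarrow> nat) \<Rightarrow> (nat \<Rightarrow> nat) \<Rightarrow> bool" where
  "break_regions n b l r \<longleftrightarrow>
     b \<ge> 1 \<and> l 0 = 0 \<and> r 0 = 0 \<and> l b = n \<and> r b = n \<and>
     (\<forall>k\<in>{1..b-1}. 1 \<le> l k \<and> l k \<le> r k \<and> r k \<le> n - 1) \<and>
     (\<forall>k. 1 \<le> k \<and> k + 1 \<le> b - 1 \<longrightarrow> r k < l (k + 1))"

definition segmentation ::
  "nat \<Rightarrow> nat \<Rightarrow> (nat \<Rightarrow> nat) \<Rightarrow> (nat \<Rightarrow> nat) \<Rightarrow> (nat \<Rightarrow> nat) \<Rightarrow> bool" where
  "segmentation n b l r bp \<longleftrightarrow>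
     bp 0 = 0 \<and> bp b = n \<and> (\<forall>k\<in>{1..b-1}. bp k \<in> {l k..r k})"

definition window :: "(nat \<Rightarrow> real) \<Rightarrow> nat \<Rightarrow> nat \<Rightarrow> real" where
  "window S t i = S (t + i - 1)"

definition fine_grained_match ::
  "nat \<Rightarrow> nat \<Rightarrow> (nat \<Rightarrow> nat) \<Rightarrow> (nat \<Rightarrow> nat) \<Rightarrow> (nat \<Rightarrow> real) \<Rightarrow>
   (nat \<Rightarrow> real) \<Rightarrow> (nat \<Rightarrow> real) \<Rightarrow> bool" where
  "fine_grained_match n b l r \<epsilon> P W \<longleftrightarrow>
     (\<exists>bp. segmentation n b l r bp \<and>
        (\<forall>k\<in>{1..b}.
           ED_norm (subsequence P (bp (k - 1) + 1) (bp k))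
                   (subsequence W (bp (k - 1) + 1) (bp k)) \<le> \<epsilon> k))"

definition md :: "(nat \<Rightarrow> nat) \<Rightarrow> (nat \<Rightarrow> nat) \<Rightarrow> (nat \<Rightarrow> real) \<Rightarrow> nat \<Rightarrow> real" where
  "md l r \<epsilon> k = \<epsilon> k * sqrt (real (r k) - real (l (k - 1)))"

text \<open>
  For break regions the intervals \<open>(l\<^sub>k, r\<^sub>k]\<close> and \<open>(r\<^sub>k\<^sub>-\<^sub>1, l\<^sub>k]\<close> partition \<open>{1..n}\<close>,
  so the descriptions below are proper on that range; the two defining clauses are
  recovered as \<open>theta_ele_break\<close> and \<open>theta_ele_between\<close>.
\<close>

definition theta_ele ::
  "nat \<Rightarrow> (nat \<Rightarrow> nat) \<Rightarrow> (nat \<Rightarrow> nat) \<Rightarrow> (nat \<Rightarrow> real) \<Rightarrow> nat \<Rightarrow> real" where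
  "theta_ele b l r \<epsilon> i =
     (if \<exists>k\<in>{1..b-1}. i \<in> {l k<..r k}
      then let k = (THE k. k \<in> {1..b-1} \<and> i \<in> {l k<..r k})
           in max (md l r \<epsilon> k) (md l r \<epsilon> (k + 1))
      else md l r \<epsilon> (THE k. k \<in> {1..b} \<and> i \<in> {r (k - 1)<..l k}))"

definition upper_elem ::
  "nat \<Rightarrow> (nat \<Rightarrow> nat) \<Rightarrow> (nat \<Rightarrow> nat) \<Rightarrow> (nat \<Rightarrow> real) \<Rightarrow> (nat \<Rightarrow> real) \<Rightarrow> nat \<Rightarrow> real" where
  "upper_elem b l r \<epsilon> P i = P i + theta_ele b l r \<epsilon> i"

definition lower_elem ::
  "nat \<Rightarrow> (nat \<Rightarrow> nat) \<Rightarrow> (nat \<Rightarrow> nat) \<Rightarrow> (nat \<Rightarrow> real) \<Rightarrow> (nat \<Rightarrow> real) \<Rightarrow> nat \<Rightarrow> real" where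
  "lower_elem b l r \<epsilon> P i = P i - theta_ele b l r \<epsilon> i"

definition P_hat_u ::
  "nat \<Rightarrow> (nat \<Rightarrow> nat) \<Rightarrow> (nat \<Rightarrow> nat) \<Rightarrow> (nat \<Rightarrow> real) \<Rightarrow> (nat \<Rightarrow> real) \<Rightarrow> nat \<Rightarrow> nat \<Rightarrow> real" where
  "P_hat_u b l r \<epsilon> P w j = Max ((\<lambda>i. upper_elem b l r \<epsilon> P (j * w - i)) ` {0..<w})"

definition P_hat_l ::
  "nat \<Rightarrow> (nat \<Rightarrow> nat) \<Rightarrow> (nat \<Rightarrow> nat) \<Rightarrow> (nat \<Rightarrow> real) \<Rightarrow> (nat \<Rightarrow> real) \<Rightarrow> nat \<Rightarrow> nat \<Rightarrow> real" where
  "P_hat_l b l r \<epsilon> P w j = Min ((\<lambda>i. lower_elem b l r \<epsilon> P (j * w - i)) ` {0..<w})"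

definition W_hat_f :: "(nat \<Rightarrow> real) \<Rightarrow> nat \<Rightarrow> nat \<Rightarrow> nat \<Rightarrow> real" where
  "W_hat_f S w t j = window S t (j * w)"

lemma break_regions_le:
  assumes "break_regions n b l r" "k \<le> b"
  shows "l k \<le> r k"
proof (cases "k = 0 \<or> k = b")
  case True
  then show ?thesis using assms by (auto simp: break_regions_def)
next
  case False
  then have "k \<in> {1..b-1}" using assms(2) by auto
  then show ?thesis using assms(1) unfolding break_regions_def by blast
qed

lemma break_regions_step:
  assumes br: "break_regions n b l r" and "n \<ge> 1" "k < b"
  shows "r k < l (Suc k)"
proof -
  have R: "1 \<le> l m \<and> r m \<le> n - 1" if "m \<in> {1..b-1}" for m
    using br that unfolding break_regions_def by blast
  consider "k = 0" "Suc k = b" | "k = 0" "Suc k < b"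
    | "1 \<le> k" "Suc k = b" | "1 \<le> k" "Suc k \<le> b - 1"
    using \<open>k < b\<close> by linarith
  then show ?thesis
  proof cases
    case 1 then show ?thesis using br \<open>n \<ge> 1\<close> by (auto simp: break_regions_def)
  next
    case 2
    then have "Suc k \<in> {1..b-1}" by auto
    from R[OF this] show ?thesis using br \<open>k = 0\<close> unfolding break_regions_def by auto
  next
    case 3
    then have "k \<in> {1..b-1}" by auto
    moreover have "l (Suc k) = n" using br 3 unfolding break_regions_def by auto
    ultimately show ?thesis using R[of k] \<open>n \<ge> 1\<close> by fastforce
  next
    case 4 then show ?thesis using br by (auto simp: break_regions_def)
  qed
qed

lemma break_regions_less:
  assumes br: "break_regions n b l r" and n: "n \<ge> 1"
  shows "k < k' \<Longrightarrow> k' \<le> b \<Longrightarrow> r k < l k'"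
proof (induction k')
  case (Suc k')
  have s: "r k' < l (Suc k')" using break_regions_step[OF br n] Suc.prems by simp
  show ?case
  proof (cases "k = k'")
    case False
    then have "r k < l k'" using Suc by simp
    moreover have "l k' \<le> r k'" using break_regions_le[OF br] Suc.prems by simp
    ultimately show ?thesis using s by linarith
  qed (use s in simp)
qed simp

lemma break_unique:
  assumes br: "break_regions n b l r" and n: "n \<ge> 1"
    and "k \<le> b" "k' \<le> b" "i \<in> {l k<..r k}" "i \<in> {l k'<..r k'}"
  shows "k = k'"
  using assms(3-) break_regions_less[OF br n, of k k'] break_regions_less[OF br n, of k' k]
  by (cases k k' rule: linorder_cases) auto

lemma between_less:
  assumes br: "break_regions n b l r" and n: "n \<ge> 1"
    and "k < k'" "k' \<le> b" "i \<in> {r (k - 1)<..l k}" "i \<in> {r (k' - 1)<..l k'}"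
  shows False
proof -
  have "l k \<le> r (k' - 1)"
  proof (cases "k = k' - 1")
    case True then show ?thesis using break_regions_le[OF br] assms(3,4) by auto
  next
    case False
    then have "k < k' - 1" "k' - 1 \<le> b" using assms(3,4) by auto
    then show ?thesis
      using break_regions_less[OF br n, of k "k' - 1"] break_regions_le[OF br, of k]
        break_regions_le[OF br, of "k' - 1"] by simp
  qed
  then show False using assms(5,6) by auto
qed

lemma break_between_disjoint:
  assumes br: "break_regions n b l r" and n: "n \<ge> 1"
    and "k \<in> {1..b-1}" "k' \<in> {1..b}" "i \<in> {l k<..r k}" "i \<in> {r (k' - 1)<..l k'}"
  shows False
proof (cases "k < k'")
  case True
  have "r k \<le> r (k' - 1)"
  proof (cases "k = k' - 1")
    case False
    then have "k < k' - 1" "k' - 1 \<le> b" using True assms(4) by auto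
    then show ?thesis
      using break_regions_less[OF br n, of k "k' - 1"] break_regions_le[OF br, of "k' - 1"]
      by simp
  qed simp
  then show False using assms(5,6) by auto
next
  case False
  have "l k' \<le> l k"
  proof (cases "k = k'")
    case neq: False
    then have "k' < k" "k \<le> b" using False assms(3) by auto
    then show ?thesis
      using break_regions_less[OF br n, of k' k] break_regions_le[OF br, of k'] by simp
  qed simp
  then show False using assms(5,6) by auto
qed

lemma break_cases:
  assumes br: "break_regions n b l r" and i: "1 \<le> i" "i \<le> n"
  obtains (break) k where "k \<in> {1..b-1}" "i \<in> {l k<..r k}"
  | (between) k where "k \<in> {1..b}" "i \<in> {r (k - 1)<..l k}"
proof -
  define k where "k = (LEAST k. i \<le> r k)"
  have rb: "i \<le> r b" and r0: "r 0 = 0" and lb: "l b = n"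
    using br i unfolding break_regions_def by auto
  have k: "i \<le> r k" "k \<le> b"
    unfolding k_def using rb LeastI[of "\<lambda>k. i \<le> r k"] Least_le[of "\<lambda>k. i \<le> r k"] by auto
  have "k \<noteq> 0" using k(1) r0 i by (cases k) auto
  then have prev: "r (k - 1) < i"
    using not_less_Least[of "k - 1" "\<lambda>k. i \<le> r k"] unfolding k_def by simp
  show thesis
  proof (cases "i \<le> l k")
    case True
    then show thesis using between[of k] prev k \<open>k \<noteq> 0\<close> by auto
  next
    case False
    then have "k \<noteq> b" using lb i by auto
    then show thesis using break[of k] False k \<open>k \<noteq> 0\<close> by auto
  qed
qed

lemma theta_ele_break:
  assumes br: "break_regions n b l r" and n: "n \<ge> 1"
    and k: "k \<in> {1..b-1}" "i \<in> {l k<..r k}"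
  shows "theta_ele b l r \<epsilon> i = max (md l r \<epsilon> k) (md l r \<epsilon> (k + 1))"
proof -
  have "(THE k. k \<in> {1..b-1} \<and> i \<in> {l k<..r k}) = k"
    by (rule the_equality) (use k break_unique[OF br n, of _ k i] in auto)
  moreover have "\<exists>k\<in>{1..b-1}. i \<in> {l k<..r k}" using k by blast
  ultimately show ?thesis unfolding theta_ele_def Let_def by presburger
qed

lemma theta_ele_between:
  assumes br: "break_regions n b l r" and n: "n \<ge> 1"
    and k: "k \<in> {1..b}" "i \<in> {r (k - 1)<..l k}"
  shows "theta_ele b l r \<epsilon> i = md l r \<epsilon> k"
proof -
  have "(THE k. k \<in> {1..b} \<and> i \<in> {r (k - 1)<..l k}) = k"
  proof (rule the_equality)
    fix m assume "m \<in> {1..b} \<and> i \<in> {r (m - 1)<..l m}"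
    then show "m = k"
      using k between_less[OF br n, of k m i] between_less[OF br n, of m k i]
      by (cases k m rule: linorder_cases) auto
  qed (use k in auto)
  moreover have "\<not> (\<exists>k\<in>{1..b-1}. i \<in> {l k<..r k})"
    using break_between_disjoint[OF br n _ k(1) _ k(2)] by blast
  ultimately show ?thesis unfolding theta_ele_def by presburger
qed

end

theory Submission
  imports Defs
begin

text \<open>
  A single coordinate difference is at most the unnormalised Euclidean distance of the segment
  containing it, and every segmentation puts \<open>i\<close> into a segment \<open>k\<close> with \<open>l\<^sub>k\<^sub>-\<^sub>1 < i \<le> r\<^sub>k\<close>,
  of length at most \<open>r\<^sub>k - l\<^sub>k\<^sub>-\<^sub>1\<close>. Hence a match at shift \<open>i\<close> confines the entry
  \<open>s\<^sub>t\<^sub>+\<^sub>i\<^sub>,\<^sub>j\<^sub>w\<^sub>-\<^sub>i\<close> to the envelope of \<open>P\<close> at \<open>jw - i\<close>, and that entry is \<open>s\<^sub>t\<^sub>,\<^sub>j\<^sub>w\<close>.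
\<close>

lemma abs_nth_diff_le_ED_norm:
  assumes "i < length xs"
  shows "\<bar>xs ! i - ys ! i\<bar> \<le> ED_norm xs ys * sqrt (real (length xs))"
proof -
  have "\<bar>xs ! i - ys ! i\<bar> ^ 2 \<le> (\<Sum>i<length xs. \<bar>xs ! i - ys ! i\<bar> ^ 2)"
    by (rule member_le_sum) (use assms in auto)
  then have "\<bar>xs ! i - ys ! i\<bar> \<le> sqrt (\<Sum>i<length xs. \<bar>xs ! i - ys ! i\<bar> ^ 2)"
    by (rule real_le_rsqrt)
  \<comment> \<open>The factor \<open>sqrt (length xs)\<close> cancels the normalisation;
    \<open>xs\<close> is nonempty because it has an index \<open>i\<close>, so the division is
    proper.\<close>
  also have "\<dots> = ED_norm xs ys * sqrt (real (length xs))"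
    using assms unfolding ED_norm_def real_sqrt_mult[symmetric] by (cases xs) auto
  finally show ?thesis .
qed

lemma abs_diff_le_ED_norm_subsequence:
  assumes "a < i" "i \<le> c"
    and "ED_norm (subsequence X (a + 1) c) (subsequence Y (a + 1) c) \<le> e"
  shows "\<bar>X i - Y i\<bar> \<le> e * sqrt (real c - real a)"
proof -
  let ?xs = "subsequence X (a + 1) c" and ?ys = "subsequence Y (a + 1) c"
  have len: "length ?xs = c - a" by (simp add: subsequence_def del: upt_Suc)
  \<comment> \<open>The list starts with entry \<open>a + 1\<close> at position 0.\<close>
  have nth: "subsequence Z (a + 1) c ! (i - a - 1) = Z i" for Z
    using assms(1,2) by (simp add: subsequence_def del: upt_Suc)
  have "\<bar>X i - Y i\<bar> \<le> ED_norm ?xs ?ys * sqrt (real (length ?xs))"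
    using abs_nth_diff_le_ED_norm[of "i - a - 1" ?xs ?ys] assms(1,2)
    unfolding nth len by linarith
  also have "\<dots> \<le> e * sqrt (real (length ?xs))"
    by (intro mult_right_mono assms) simp
  finally show ?thesis using assms(1,2) unfolding len by (simp add: of_nat_diff)
qed

text \<open>The range splits into break region \<open>k - 1\<close>, the gap after it and break
  region \<open>k\<close>; \<open>md k\<close> is an argument of the maximum on both regions and the
  value itself on the gap.\<close>

lemma md_le_theta_ele:
  assumes br: "break_regions n b l r" and n: "n \<ge> 1"
    and k: "k \<in> {1..b}" and i: "l (k - 1) < i" "i \<le> r k"
  shows "md l r \<epsilon> k \<le> theta_ele b l r \<epsilon> i"
proof -
  have ends: "l 0 = 0" "r 0 = 0" "l b = n" "r b = n"
    using br unfolding break_regions_def by auto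
  consider "i \<le> r (k - 1)" | "r (k - 1) < i" "i \<le> l k" | "l k < i"
    by linarith
  then show ?thesis
  proof cases
    case 1
    then have "k - 1 \<noteq> 0" using i ends by (metis leD)
    then have "k - 1 \<in> {1..b-1}" using k by auto
    then show ?thesis using theta_ele_break[OF br n, of "k - 1" i] 1 i k by simp
  next
    case 2
    then show ?thesis using theta_ele_between[OF br n k] by simp
  next
    case 3
    \<comment> \<open>Since \<open>l b = r b = n\<close>, no index lies beyond \<open>l b\<close>
      and within \<open>r b\<close>.\<close>
    then have "k \<noteq> b" using i ends by auto
    then have "k \<in> {1..b-1}" using k by auto
    then show ?thesis using theta_ele_break[OF br n, of k i] 3 i by simp
  qed
qed

text \<open>The conventions at 0 and \<open>b\<close> act as one-point regions, so the first and
  last segments need no separate treatment later.\<close>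

lemma segmentation_bounds:
  assumes "break_regions n b l r" "segmentation n b l r bp" "k \<le> b"
  shows "l k \<le> bp k" "bp k \<le> r k"
proof -
  have "l k \<le> bp k \<and> bp k \<le> r k"
  proof (cases "k = 0 \<or> k = b")
    case True
    then show ?thesis using assms unfolding break_regions_def segmentation_def by auto
  next
    case False
    then have "k \<in> {1..b-1}" using assms(3) by auto
    then show ?thesis using assms(2) unfolding segmentation_def by auto
  qed
  then show "l k \<le> bp k" "bp k \<le> r k" by auto
qed

lemma segmentation_segment:
  assumes "segmentation n b l r bp" "1 \<le> i" "i \<le> n"
  obtains k where "k \<in> {1..b}" "bp (k - 1) < i" "i \<le> bp k"
proof -
  \<comment> \<open>Such an index exists because \<open>bp b = n\<close>, and it is positive because
    \<open>bp 0 = 0 < i\<close>; minimality then gives \<open>bp (k - 1) < i\<close>.\<close>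
  define k where "k = (LEAST k. i \<le> bp k)"
  have bp: "bp 0 = 0" "i \<le> bp b" using assms unfolding segmentation_def by auto
  have k: "i \<le> bp k" "k \<le> b"
    unfolding k_def using bp(2) by (auto intro: LeastI Least_le)
  moreover have "k \<noteq> 0" using k(1) bp(1) assms(2) by (metis not_one_le_zero le_trans)
  moreover from this have "bp (k - 1) < i"
    using not_less_Least[of "k - 1" "\<lambda>k. i \<le> bp k"] unfolding k_def by simp
  ultimately show thesis using that[of k] by simp
qed

lemma fine_grained_match_abs_diff_le:
  assumes br: "break_regions n b l r" and eps: "\<And>k. k \<in> {1..b} \<Longrightarrow> \<epsilon> k \<ge> 0"
    and match: "fine_grained_match n b l r \<epsilon> P W" and i: "1 \<le> i" "i \<le> n"
  shows "\<bar>P i - W i\<bar> \<le> theta_ele b l r \<epsilon> i"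
proof -
  obtain bp where seg: "segmentation n b l r bp"
    and ED: "\<And>k. k \<in> {1..b} \<Longrightarrow>
      ED_norm (subsequence P (bp (k - 1) + 1) (bp k)) (subsequence W (bp (k - 1) + 1) (bp k)) \<le> \<epsilon> k"
    using match unfolding fine_grained_match_def by blast
  obtain k where k: "k \<in> {1..b}" "bp (k - 1) < i" "i \<le> bp k"
    using segmentation_segment[OF seg i] .
  have lo: "l (k - 1) \<le> bp (k - 1)" and hi: "bp k \<le> r k"
    using segmentation_bounds[OF br seg] k(1) by auto
  have "\<bar>P i - W i\<bar> \<le> \<epsilon> k * sqrt (real (bp k) - real (bp (k - 1)))"
    using abs_diff_le_ED_norm_subsequence k(2,3) ED[OF k(1)] .
  \<comment> \<open>The segment is longest when it runs from \<open>l (k - 1)\<close> to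
    \<open>r k\<close>; \<open>\<epsilon> k \<ge> 0\<close> preserves the inequality.\<close>
  also have "\<dots> \<le> md l r \<epsilon> k"
    unfolding md_def using lo hi eps[OF k(1)] by (intro mult_left_mono) auto
  also have "\<dots> \<le> theta_ele b l r \<epsilon> i"
    using br k i lo hi by (intro md_le_theta_ele[of n]) auto
  finally show ?thesis .
qed

theorem mainTheorem1:
  fixes n b w :: nat
    and l r :: "nat \<Rightarrow> nat"
    and \<epsilon> P S :: "nat \<Rightarrow> real"
  assumes "break_regions n b l r"
    and "\<And>k. k \<in> {1..b} \<Longrightarrow> \<epsilon> k \<ge> 0"
    and "1 \<le> w" and "w \<le> n"
  shows "\<forall>t\<ge>1. (\<exists>i\<in>{0..w-1}. fine_grained_match n b l r \<epsilon> P (window S (t + i))) \<longrightarrow>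
           (\<forall>j\<in>{1..n div w}.
              P_hat_l b l r \<epsilon> P w j \<le> W_hat_f S w t j \<and>
              W_hat_f S w t j \<le> P_hat_u b l r \<epsilon> P w j)"
proof (intro allI impI ballI)
  fix t j :: nat
  assume "1 \<le> t" and ex: "\<exists>i\<in>{0..w-1}. fine_grained_match n b l r \<epsilon> P (window S (t + i))"
    and j: "j \<in> {1..n div w}"
  from ex obtain i where "i \<in> {0..w-1}"
    and match: "fine_grained_match n b l r \<epsilon> P (window S (t + i))" by blast
  then have iw: "i < w" using \<open>1 \<le> w\<close> by auto
  \<comment> \<open>With \<open>i < w\<close> this keeps the truncated difference
    \<open>j * w - i\<close> exact and at least 1.\<close>
  have "w \<le> j * w" using j by simp
  have "j * w \<le> n div w * w" using j by (intro mult_le_mono1) simp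
  also have "\<dots> \<le> n" by simp
  finally have jn: "j * w \<le> n" .
  have "t + i + (j * w - i) = t + j * w" using iw \<open>w \<le> j * w\<close> by linarith
  then have "window S (t + i) (j * w - i) = W_hat_f S w t j"
    by (simp only: window_def W_hat_f_def)
  moreover have "\<bar>P (j * w - i) - window S (t + i) (j * w - i)\<bar> \<le> theta_ele b l r \<epsilon> (j * w - i)"
  proof (rule fine_grained_match_abs_diff_le[OF assms(1,2) match])
    show "1 \<le> j * w - i" "j * w - i \<le> n" using iw \<open>w \<le> j * w\<close> jn by linarith+
  qed
  ultimately have
    "lower_elem b l r \<epsilon> P (j * w - i) \<le> W_hat_f S w t j"
    "W_hat_f S w t j \<le> upper_elem b l r \<epsilon> P (j * w - i)"
    unfolding lower_elem_def upper_elem_def by linarith+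
  moreover have "P_hat_l b l r \<epsilon> P w j \<le> lower_elem b l r \<epsilon> P (j * w - i)"
    unfolding P_hat_l_def using iw by (intro Min_le) auto
  moreover have "upper_elem b l r \<epsilon> P (j * w - i) \<le> P_hat_u b l r \<epsilon> P w j"
    unfolding P_hat_u_def using iw by (intro Max_ge) auto
  ultimately show "P_hat_l b l r \<epsilon> P w j \<le> W_hat_f S w t j \<and>
      W_hat_f S w t j \<le> P_hat_u b l r \<epsilon> P w j"
    by linarith
qed

end
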